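(* Let $(A,\prec,\succ)$ be a dendriform algebra over $\mathbb{K}$ and let $D_1,D_2:A\to A$ be $\mathbb{K}$-linear maps satisfying, for $i=1,2$ and all $a,b\in A$, $$D_i(a\prec b)=a\prec(D_ib)+(D_ia)\prec b,\qquad D_i(a\succ b)=a\succ(D_ib)+(D_ia)\succ b.$$ If moreover $D_1\circ D_2=D_2\circ D_1$, then $$a\prec_t b=\sum_{n=0}^\infty\frac{t^n}{n!}\,D_1^n(a)\prec D_2^n(b),\qquad a\succ_t b=\sum_{n=0}^\infty\frac{t^n}{n!}\,D_1^n(a)\succ D_2^n(b)$$ defines a formal $1$-parameter deformation of $A$.
   Context: $\mathbb{K}$ is a field of characteristic $0$. Dendriform algebra: a vector space $A$ with bilinear $\prec,\succ$ satisfying $(a\prec b)\prec c=a\prec(b\prec c+b\succ c)$, $(a\succ b)\prec c=a\succ(b\prec c)$, $(a\prec b+a\succ b)\succ c=a\succ(b\succ c)$. A formal $1$-parameter deformation of $A$ is a pair of $\mathbb{K}[[t]]$-bilinear maps $\prec_t,\succ_t:A[[t]]\times A[[t]]\to A[[t]]$ of the form $a\prec_t b=\sum_{i\ge0}(a\prec_i b)t^i$, $a\succ_t b=\sum_{i\ge0}(a\succ_i b)t^i$ for $a,b\in A$ (extended $t$-adically, with $\prec_i,\succ_i:A\otimes A\to A$ bilinear), with $\prec_0=\prec$, $\succ_0=\succ$, such that $(A[[t]],\prec_t,\succ_t)$ is a dendriform algebra. *)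

theory Defs
  imports "HOL-Computational_Algebra.Formal_Power_Series"
begin

unbundle fps_syntax

definition bilinear_map ::
    "('k::comm_ring_1 \<Rightarrow> 'a::ab_group_add \<Rightarrow> 'a) \<Rightarrow> ('a \<Rightarrow> 'a \<Rightarrow> 'a) \<Rightarrow> bool" where
  "bilinear_map scale p \<longleftrightarrow>
     (\<forall>a. module_hom scale scale (\<lambda>b. p a b)) \<and> (\<forall>b. module_hom scale scale (\<lambda>a. p a b))"

text \<open>
  The scalars form an arbitrary commutative ring, so that the same notion applies to a vector
  space \<open>A\<close> over a field \<open>K\<close> (for a field of scalars, \<open>module\<close> and \<open>vector_space\<close> coincide, see
  \<open>module_iff_vector_space\<close>) and to the \<open>K[[t]]\<close>-module \<open>A[[t]]\<close>.
\<close>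

locale dendriform_algebra = module scale
  for scale :: "'k::comm_ring_1 \<Rightarrow> 'a::ab_group_add \<Rightarrow> 'a" +
  fixes lprod :: "'a \<Rightarrow> 'a \<Rightarrow> 'a" (infixl \<open>\<prec>\<close> 70)
    and rprod :: "'a \<Rightarrow> 'a \<Rightarrow> 'a" (infixl \<open>\<succ>\<close> 70)
  assumes bilinear_lprod: "bilinear_map scale (\<prec>)"
    and bilinear_rprod: "bilinear_map scale (\<succ>)"
    and dendriform1: "(a \<prec> b) \<prec> c = a \<prec> (b \<prec> c + b \<succ> c)"
    and dendriform2: "(a \<succ> b) \<prec> c = a \<succ> (b \<prec> c)"
    and dendriform3: "(a \<prec> b + a \<succ> b) \<succ> c = a \<succ> (b \<succ> c)"

text \<open>
  \<open>A[[t]]\<close> is the type \<open>'a fps\<close>, with \<open>A\<close> embedded by \<^const>\<open>fps_const\<close>. Its \<open>K[[t]]\<close>-module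
  structure is the Cauchy product.
\<close>

definition fps_scale ::
    "('k::comm_ring_1 \<Rightarrow> 'a::ab_group_add \<Rightarrow> 'a) \<Rightarrow> 'k fps \<Rightarrow> 'a fps \<Rightarrow> 'a fps" where
  "fps_scale scale c f = Abs_fps (\<lambda>n. \<Sum>i=0..n. scale (c $ i) (f $ (n - i)))"

text \<open>
  The \<open>t\<close>-adic extension to \<open>A[[t]]\<close> of \<open>(a, b) \<mapsto> \<Sum>i. p i a b t^i\<close>: the coefficient of \<open>t^n\<close> in
  \<open>\<Sum>i j k. p i (f $ j) (g $ k) t^(i+j+k)\<close>.
\<close>

definition tadic_extension ::
    "(nat \<Rightarrow> 'a::ab_group_add \<Rightarrow> 'a \<Rightarrow> 'a) \<Rightarrow> 'a fps \<Rightarrow> 'a fps \<Rightarrow> 'a fps" where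
  "tadic_extension p f g =
     Abs_fps (\<lambda>n. \<Sum>i=0..n. \<Sum>j=0..n-i. p i (f $ j) (g $ (n - i - j)))"

lemma tadic_extension_const:
  assumes "\<And>i. bilinear_map scale (p i)"
  shows "tadic_extension p (fps_const a) (fps_const b) = Abs_fps (\<lambda>n. p n a b)"
proof (rule fps_ext)
  fix n
  have z: "p i 0 y = 0" "p i x 0 = 0" for i x y
    using assms[of i] module_hom.zero unfolding bilinear_map_def by blast+
  have "(\<Sum>j=0..n-i. p i (fps_const a $ j) (fps_const b $ (n - i - j)))
      = (if i = n then p n a b else 0)" if "i \<in> {0..n}" for i
  proof -
    have "(\<Sum>j=0..n-i. p i (fps_const a $ j) (fps_const b $ (n - i - j)))
        = (\<Sum>j=0..n-i. if j = 0 then p i a (fps_const b $ (n - i)) else 0)"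
      by (rule sum.cong) (auto simp: z)
    then show ?thesis using that by (auto simp: z)
  qed
  then show "tadic_extension p (fps_const a) (fps_const b) $ n = Abs_fps (\<lambda>n. p n a b) $ n"
    by (simp add: tadic_extension_def)
qed

text \<open>\<open>K[[t]]\<close>-bilinearity of \<open>lt\<close> and \<open>rt\<close> is part of \<^const>\<open>dendriform_algebra\<close>.\<close>

definition formal_deformation ::
    "('k::field \<Rightarrow> 'a::ab_group_add \<Rightarrow> 'a) \<Rightarrow> ('a \<Rightarrow> 'a \<Rightarrow> 'a) \<Rightarrow> ('a \<Rightarrow> 'a \<Rightarrow> 'a) \<Rightarrow>
     ('a fps \<Rightarrow> 'a fps \<Rightarrow> 'a fps) \<Rightarrow> ('a fps \<Rightarrow> 'a fps \<Rightarrow> 'a fps) \<Rightarrow> bool" where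
  "formal_deformation scale l r lt rt \<longleftrightarrow>
     (\<exists>p q. (\<forall>i. bilinear_map scale (p i)) \<and> (\<forall>i. bilinear_map scale (q i)) \<and>
            p 0 = l \<and> q 0 = r \<and>
            lt = tadic_extension p \<and> rt = tadic_extension q) \<and>
     dendriform_algebra (fps_scale scale) lt rt"

end

theory Submission
  imports Defs
begin

text \<open>
  Formally the deformed products are \<open>p \<circ> exp (t D1 \<otimes> D2)\<close>, where \<open>p\<close> is \<open>\<prec>\<close> or \<open>\<succ>\<close>. A derivation \<open>D\<close>
  of a product \<open>q\<close> satisfies \<open>D \<circ> q = q \<circ> (D \<otimes> 1 + 1 \<otimes> D)\<close>. Therefore, if \<open>D1\<close> is a derivation of \<open>q\<close>
  and \<open>D2\<close> one of \<open>q'\<close>, both deformed bracketings \<open>(a q b) p c\<close> and \<open>a p' (b q' c)\<close> arise from the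
  undeformed ones by first applying to \<open>a \<otimes> b \<otimes> c\<close> the same operator
  \<open>exp (t (D1 \<otimes> D2 \<otimes> 1 + D1 \<otimes> 1 \<otimes> D2 + 1 \<otimes> D1 \<otimes> D2))\<close>, whose three exponents commute because
  \<open>D1\<close> and \<open>D2\<close> do. Hence an identity \<open>(a q b) p c = a p' (b q' c)\<close> survives the deformation.

  The three dendriform axioms all have this shape, with \<open>p, q, p', q'\<close> among \<open>\<prec>\<close>, \<open>\<succ>\<close> and their sum
  \<open>\<prec> + \<succ>\<close>, which has the same derivations and deforms to the sum of the deformed products. The
  coefficientwise form of the argument on \<open>A\<close> is \<open>exp_twist_assoc\<close>, and \<open>tadic_extension_assoc\<close>
  carries it over to \<open>A[[t]]\<close>; \<open>bilinear_map_tadic_extension\<close> supplies \<open>K[[t]]\<close>-bilinearity.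
\<close>

section \<open>Bilinear maps and the Leibniz rule\<close>

lemma bilinear_map_simps:
  assumes "bilinear_map scale p"
  shows "p (a + a') b = p a b + p a' b" "p a (b + b') = p a b + p a b'"
    and "p (scale c a) b = scale c (p a b)" "p a (scale c b) = scale c (p a b)"
    and "p (\<Sum>i\<in>I. f i) b = (\<Sum>i\<in>I. p (f i) b)" "p a (\<Sum>i\<in>I. f i) = (\<Sum>i\<in>I. p a (f i))"
proof -
  have l: "module_hom scale scale (\<lambda>a. p a b)" for b
    using assms by (simp add: bilinear_map_def)
  have r: "module_hom scale scale (\<lambda>b. p a b)" for a
    using assms by (simp add: bilinear_map_def)
  show "p (a + a') b = p a b + p a' b" "p (scale c a) b = scale c (p a b)"
    "p (\<Sum>i\<in>I. f i) b = (\<Sum>i\<in>I. p (f i) b)"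
    using module_hom.add[OF l] module_hom.scale[OF l] module_hom.sum[OF l] by auto
  show "p a (b + b') = p a b + p a b'" "p a (scale c b) = scale c (p a b)"
    "p a (\<Sum>i\<in>I. f i) = (\<Sum>i\<in>I. p a (f i))"
    using module_hom.add[OF r] module_hom.scale[OF r] module_hom.sum[OF r] by auto
qed

lemma bilinear_map_module: "bilinear_map scale p \<Longrightarrow> module scale"
  by (auto simp: bilinear_map_def module_hom_def)

lemma bilinear_mapI:
  assumes "module scale"
    and "\<And>a a' b. p (a + a') b = p a b + p a' b" "\<And>a b b'. p a (b + b') = p a b + p a b'"
    and "\<And>c a b. p (scale c a) b = scale c (p a b)" "\<And>c a b. p a (scale c b) = scale c (p a b)"
  shows "bilinear_map scale p"
  using assms by (auto simp: bilinear_map_def module_hom_def module_hom_axioms_def)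

lemma bilinear_map_add:
  assumes "bilinear_map scale p" "bilinear_map scale q"
  shows "bilinear_map scale (\<lambda>a b. p a b + q a b)"
proof -
  interpret module scale by (rule bilinear_map_module[OF assms(1)])
  show ?thesis
    using module_axioms
    by (rule bilinear_mapI) (simp_all add: bilinear_map_simps[OF assms(1)]
        bilinear_map_simps[OF assms(2)] scale_right_distrib algebra_simps)
qed

lemma module_hom_funpow:
  assumes "module_hom scale scale D"
  shows "module_hom scale scale (D ^^ n)"
proof (induction n)
  case 0
  have "module scale" using assms by (simp add: module_hom_def)
  then show ?case by (simp add: module_hom_def module_hom_axioms_def)
next
  case (Suc n)
  then show ?case using module_hom_compose[OF Suc assms] by (simp add: comp_def)
qed

lemma funpow_commute:
  assumes "f \<circ> g = g \<circ> f"
  shows "(f ^^ m) ((g ^^ n) x) = (g ^^ n) ((f ^^ m) x)"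
proof -
  have fg: "f (g y) = g (f y)" for y using assms by (metis comp_apply)
  have fgn: "f ((g ^^ n) y) = (g ^^ n) (f y)" for y
    by (induction n) (simp_all add: fg)
  show ?thesis by (induction m) (simp_all add: fgn)
qed

lemma derivation_funpow:
  assumes p: "bilinear_map scale p" and D: "module_hom scale scale D"
    and deriv: "\<And>a b. D (p a b) = p a (D b) + p (D a) b"
  shows "(D ^^ n) (p a b) = (\<Sum>k\<le>n. scale (of_nat (n choose k)) (p ((D ^^ k) a) ((D ^^ (n - k)) b)))"
proof (induction n)
  case 0
  interpret module scale by (rule bilinear_map_module[OF p])
  show ?case by simp
next
  case (Suc n)
  interpret module scale by (rule bilinear_map_module[OF p])
  let ?g = "\<lambda>k. p ((D ^^ k) a) ((D ^^ (Suc n - k)) b)"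
  have "(D ^^ Suc n) (p a b) = (\<Sum>k\<le>n. scale (of_nat (n choose k)) (?g k))
      + (\<Sum>k\<le>n. scale (of_nat (n choose k)) (?g (Suc k)))"
    by (simp add: Suc module_hom.sum[OF D] module_hom.scale[OF D] deriv scale_right_distrib
        sum.distrib Suc_diff_le)
  also have "(\<Sum>k\<le>n. scale (of_nat (n choose k)) (?g k))
      = (\<Sum>k\<le>Suc n. scale (of_nat (n choose k)) (?g k))"
    by (simp add: binomial_eq_0)
  also have "\<dots> = ?g 0 + (\<Sum>k\<le>n. scale (of_nat (n choose Suc k)) (?g (Suc k)))"
    by (subst sum.atMost_Suc_shift) simp
  also have "\<dots> + (\<Sum>k\<le>n. scale (of_nat (n choose k)) (?g (Suc k)))
      = ?g 0 + (\<Sum>k\<le>n. scale (of_nat (Suc n choose Suc k)) (?g (Suc k)))"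
    by (simp add: scale_left_distrib sum.distrib add.assoc add.commute)
  also have "\<dots> = (\<Sum>k\<le>Suc n. scale (of_nat (Suc n choose k)) (?g k))"
    by (subst sum.atMost_Suc_shift) simp
  finally show ?case .
qed

text \<open>
  Leibniz rule for the divided powers \<open>D\<^sup>n / n!\<close>, in which the binomial coefficients disappear.
\<close>

lemma derivation_divided_power:
  fixes scale :: "'k::field_char_0 \<Rightarrow> 'a::ab_group_add \<Rightarrow> 'a"
  assumes p: "bilinear_map scale p" and D: "module_hom scale scale D"
    and deriv: "\<And>a b. D (p a b) = p a (D b) + p (D a) b"
  shows "scale (1 / fact n) ((D ^^ n) (p a b))
    = (\<Sum>k\<le>n. scale (1 / (fact k * fact (n - k))) (p ((D ^^ k) a) ((D ^^ (n - k)) b)))"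
proof -
  interpret module scale by (rule bilinear_map_module[OF p])
  have "1 / fact n * of_nat (n choose k) = (1 / (fact k * fact (n - k)) :: 'k)" if "k \<le> n" for k
    using that by (simp add: binomial_fact)
  then show ?thesis
    unfolding derivation_funpow[OF assms] scale_sum_right scale_scale by (intro sum.cong) auto
qed

section \<open>The module of formal power series and t-adic extensions\<close>

text \<open>
  Coefficients of \<open>t^n\<close> are written as sums over all index tuples of total degree \<open>n\<close>, so that nested
  sums can be rearranged by explicit bijections.
\<close>

definition triples :: "nat \<Rightarrow> (nat \<times> nat \<times> nat) set" where
  "triples n = {(i, j, k). i + j + k = n}"

lemma finite_triples [simp]: "finite (triples n)"
  by (rule finite_subset[of _ "{..n} \<times> {..n} \<times> {..n}"]) (auto simp: triples_def)

lemma sum_triples: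
  fixes F :: "nat \<Rightarrow> nat \<Rightarrow> nat \<Rightarrow> 'a::comm_monoid_add"
  shows "(\<Sum>(i, j, k)\<in>triples n. F i j k) = (\<Sum>i=0..n. \<Sum>j=0..n-i. F i j (n - i - j))"
  unfolding sum.Sigma[OF finite_atLeastAtMost ballI[OF finite_atLeastAtMost]]
  by (rule sum.reindex_bij_witness[where i = "\<lambda>(i, j). (i, j, n - i - j)" and j = "\<lambda>(i, j, k). (i, j)"])
     (auto simp: triples_def)

lemma tadic_extension_nth:
  "tadic_extension p f g $ n = (\<Sum>(i, j, k)\<in>triples n. p i (f $ j) (g $ k))"
  by (simp add: tadic_extension_def sum_triples)

lemma tadic_extension_add_family:
  "tadic_extension (\<lambda>i a b. p i a b + q i a b) f g = tadic_extension p f g + tadic_extension q f g"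
  by (rule fps_ext) (simp add: tadic_extension_def sum.distrib)

lemma fps_scale_nth: "fps_scale scale c f $ n = (\<Sum>(i, j)\<in>{(i, j). i + j = n}. scale (c $ i) (f $ j))"
  unfolding fps_scale_def fps_nth_Abs_fps
  by (rule sum.reindex_bij_witness[where j = "\<lambda>i. (i, n - i)" and i = fst]) auto

lemma finite_pairs [simp]: "finite {ij. fst ij + snd ij = (n::nat)}"
  by (rule finite_subset[of _ "{..n} \<times> {..n}"]) auto

lemma module_fps_scale:
  assumes "module scale"
  shows "module (fps_scale scale)"
proof
  interpret module scale by fact
  fix c d :: "'a fps" and f g :: "'b fps"
  show "fps_scale scale c (f + g) = fps_scale scale c f + fps_scale scale c g"
    by (rule fps_ext) (simp add: fps_scale_def scale_right_distrib sum.distrib)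
  show "fps_scale scale (c + d) f = fps_scale scale c f + fps_scale scale d f"
    by (rule fps_ext) (simp add: fps_scale_def scale_left_distrib sum.distrib)
  show "fps_scale scale 1 f = f"
  proof (rule fps_ext)
    fix n
    have "fps_scale scale 1 f $ n = (\<Sum>i=0..n. if i = 0 then f $ n else 0)"
      unfolding fps_scale_def fps_nth_Abs_fps by (intro sum.cong) auto
    then show "fps_scale scale 1 f $ n = f $ n" by simp
  qed
  show "fps_scale scale c (fps_scale scale d f) = fps_scale scale (c * d) f"
  proof (rule fps_ext)
    fix n
    have "fps_scale scale c (fps_scale scale d f) $ n
        = (\<Sum>i=0..n. \<Sum>j=0..n-i. scale (c $ i * d $ j) (f $ (n - i - j)))"
      by (simp add: fps_scale_def scale_sum_right)
    also have "\<dots> = (\<Sum>(i, j, k)\<in>triples n. scale (c $ i * d $ j) (f $ k))"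
      by (rule sum_triples[symmetric])
    also have "\<dots> = (\<Sum>(l, i)\<in>(SIGMA l:{0..n}. {0..l}). scale (c $ i * d $ (l - i)) (f $ (n - l)))"
      by (rule sum.reindex_bij_witness[where i = "\<lambda>(l, i). (i, l - i, n - l)"
            and j = "\<lambda>(i, j, k). (i + j, i)"]) (auto simp: triples_def)
    also have "\<dots> = fps_scale scale (c * d) f $ n"
      by (simp add: fps_scale_def fps_mult_nth scale_sum_left sum.Sigma)
    finally show "fps_scale scale c (fps_scale scale d f) $ n = fps_scale scale (c * d) f $ n" .
  qed
qed

lemma bilinear_map_tadic_extension:
  assumes p: "\<And>i. bilinear_map scale (p i)"
  shows "bilinear_map (fps_scale scale) (tadic_extension p)"
proof (rule bilinear_mapI)
  have mod: "module scale" by (rule bilinear_map_module[OF p])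
  then interpret module scale .
  note simps = bilinear_map_simps[OF p]
  show "module (fps_scale scale)" by (rule module_fps_scale[OF mod])
  fix c and f f' g g' :: "'b fps"
  show "tadic_extension p (f + f') g = tadic_extension p f g + tadic_extension p f' g"
    "tadic_extension p f (g + g') = tadic_extension p f g + tadic_extension p f g'"
    by (rule fps_ext, simp add: tadic_extension_def simps sum.distrib)+
  let ?P = "\<lambda>n. {(i, j). i + j = (n::nat)}"
  show "tadic_extension p (fps_scale scale c f) g = fps_scale scale c (tadic_extension p f g)"
  proof (rule fps_ext)
    fix n
    have "tadic_extension p (fps_scale scale c f) g $ n
        = (\<Sum>((i, x, k), (m, j))\<in>(SIGMA (i, x, k):triples n. ?P x).
            scale (c $ m) (p i (f $ j) (g $ k)))"
      by (simp add: tadic_extension_nth fps_scale_nth simps case_prod_unfold sum.Sigma)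
    also have "\<dots> = (\<Sum>((m, x), (i, j, k))\<in>(SIGMA (m, x):?P n. triples x).
            scale (c $ m) (p i (f $ j) (g $ k)))"
      by (rule sum.reindex_bij_witness[where i = "\<lambda>((m, x), (i, j, k)). ((i, m + j, k), (m, j))"
            and j = "\<lambda>((i, x, k), (m, j)). ((m, i + j + k), (i, j, k))"])
         (auto simp: triples_def)
    also have "\<dots> = fps_scale scale c (tadic_extension p f g) $ n"
      by (simp add: tadic_extension_nth fps_scale_nth scale_sum_right case_prod_unfold sum.Sigma)
    finally show "tadic_extension p (fps_scale scale c f) g $ n
        = fps_scale scale c (tadic_extension p f g) $ n" .
  qed
  show "tadic_extension p f (fps_scale scale c g) = fps_scale scale c (tadic_extension p f g)"
  proof (rule fps_ext)
    fix n
    have "tadic_extension p f (fps_scale scale c g) $ n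
        = (\<Sum>((i, j, x), (m, k))\<in>(SIGMA (i, j, x):triples n. ?P x).
            scale (c $ m) (p i (f $ j) (g $ k)))"
      by (simp add: tadic_extension_nth fps_scale_nth simps case_prod_unfold sum.Sigma)
    also have "\<dots> = (\<Sum>((m, x), (i, j, k))\<in>(SIGMA (m, x):?P n. triples x).
            scale (c $ m) (p i (f $ j) (g $ k)))"
      by (rule sum.reindex_bij_witness[where i = "\<lambda>((m, x), (i, j, k)). ((i, j, m + k), (m, k))"
            and j = "\<lambda>((i, j, x), (m, k)). ((m, i + j + k), (i, j, k))"])
         (auto simp: triples_def)
    also have "\<dots> = fps_scale scale c (tadic_extension p f g) $ n"
      by (simp add: tadic_extension_nth fps_scale_nth scale_sum_right case_prod_unfold sum.Sigma)
    finally show "tadic_extension p f (fps_scale scale c g) $ n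
        = fps_scale scale c (tadic_extension p f g) $ n" .
  qed
qed

text \<open>
  An identity of associativity type between four t-adic extensions can be checked on \<open>A\<close>, degree by
  degree: this is the usual system of deformation equations.
\<close>

lemma tadic_extension_assoc:
  assumes p: "\<And>i. bilinear_map scale (p i)" and p': "\<And>i. bilinear_map scale (p' i)"
    and eq: "\<And>n a b c. (\<Sum>i\<le>n. p i (q (n - i) a b) c) = (\<Sum>i\<le>n. p' i a (q' (n - i) b c))"
  shows "tadic_extension p (tadic_extension q f g) h = tadic_extension p' f (tadic_extension q' g h)"
proof (rule fps_ext)
  fix N
  \<comment> \<open>\<open>n\<close> is the degree contributed by the two products, \<open>N - n\<close> that of the coefficients of \<open>f\<close>, \<open>g\<close>, \<open>h\<close>\<close>
  let ?Q = "SIGMA n:{..N}. triples (N - n)"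
  have "tadic_extension p (tadic_extension q f g) h $ N
      = (\<Sum>((i, x, m), (j, k, l))\<in>(SIGMA (i, x, m):triples N. triples x).
          p i (q j (f $ k) (g $ l)) (h $ m))"
    by (simp add: tadic_extension_nth bilinear_map_simps[OF p] case_prod_unfold sum.Sigma)
  also have "\<dots> = (\<Sum>((n, (k, l, m)), i)\<in>(SIGMA (n, _):?Q. {..n}).
          p i (q (n - i) (f $ k) (g $ l)) (h $ m))"
    by (rule sum.reindex_bij_witness
          [where i = "\<lambda>((n, (k, l, m)), i). ((i, n - i + k + l, m), (n - i, k, l))"
            and j = "\<lambda>((i, x, m), (j, k, l)). ((i + j, (k, l, m)), i)"])
       (auto simp: triples_def)
  also have "\<dots> = (\<Sum>(n, (k, l, m))\<in>?Q. \<Sum>i\<le>n. p i (q (n - i) (f $ k) (g $ l)) (h $ m))"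
    by (simp add: sum.Sigma case_prod_unfold)
  also have "\<dots> = (\<Sum>(n, (k, l, m))\<in>?Q. \<Sum>i\<le>n. p' i (f $ k) (q' (n - i) (g $ l) (h $ m)))"
    by (simp add: eq)
  also have "\<dots> = (\<Sum>((n, (k, l, m)), i)\<in>(SIGMA (n, _):?Q. {..n}).
          p' i (f $ k) (q' (n - i) (g $ l) (h $ m)))"
    by (simp add: sum.Sigma case_prod_unfold)
  also have "\<dots> = (\<Sum>((i, k, x), (j, l, m))\<in>(SIGMA (i, k, x):triples N. triples x).
          p' i (f $ k) (q' j (g $ l) (h $ m)))"
    by (rule sum.reindex_bij_witness
          [where j = "\<lambda>((n, (k, l, m)), i). ((i, k, n - i + l + m), (n - i, l, m))"
            and i = "\<lambda>((i, k, x), (j, l, m)). ((i + j, (k, l, m)), i)"])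
       (auto simp: triples_def)
  also have "\<dots> = tadic_extension p' f (tadic_extension q' g h) $ N"
    by (simp add: tadic_extension_nth bilinear_map_simps[OF p'] case_prod_unfold sum.Sigma)
  finally show "tadic_extension p (tadic_extension q f g) h $ N
      = tadic_extension p' f (tadic_extension q' g h) $ N" .
qed

section \<open>Exponential twists by commuting derivations\<close>

text \<open>The coefficient of \<open>t^n\<close> in \<open>p \<circ> exp (t D1 \<otimes> D2)\<close>, as a bilinear map on \<open>A\<close>.\<close>

definition exp_twist ::
    "('k::field_char_0 \<Rightarrow> 'a::ab_group_add \<Rightarrow> 'a) \<Rightarrow> ('a \<Rightarrow> 'a) \<Rightarrow> ('a \<Rightarrow> 'a) \<Rightarrow>
     ('a \<Rightarrow> 'a \<Rightarrow> 'a) \<Rightarrow> nat \<Rightarrow> 'a \<Rightarrow> 'a \<Rightarrow> 'a" where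
  "exp_twist scale D1 D2 p n a b = scale (1 / fact n) (p ((D1 ^^ n) a) ((D2 ^^ n) b))"

lemma bilinear_map_exp_twist:
  assumes p: "bilinear_map scale p"
    and D1: "module_hom scale scale D1" and D2: "module_hom scale scale D2"
  shows "bilinear_map scale (exp_twist scale D1 D2 p n)"
proof -
  interpret module scale by (rule bilinear_map_module[OF p])
  note D1n = module_hom_funpow[OF D1, of n] and D2n = module_hom_funpow[OF D2, of n]
  show ?thesis
    using module_axioms
    by (rule bilinear_mapI) (simp_all add: exp_twist_def bilinear_map_simps[OF p]
        module_hom.add[OF D1n] module_hom.add[OF D2n] module_hom.scale[OF D1n]
        module_hom.scale[OF D2n] scale_right_distrib mult.commute)
qed

lemma exp_twist_add:
  assumes "module scale"
  shows "exp_twist scale D1 D2 (\<lambda>a b. p a b + q a b)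
    = (\<lambda>n a b. exp_twist scale D1 D2 p n a b + exp_twist scale D1 D2 q n a b)"
  using assms by (intro ext) (simp add: exp_twist_def module.scale_right_distrib)

text \<open>
  Only \<open>q\<close> needs to be compatible with \<open>D1\<close>, and only \<open>q'\<close> with \<open>D2\<close>, since these are the products
  to which a power of \<open>D1\<close>, respectively \<open>D2\<close>, gets applied.
\<close>

lemma exp_twist_assoc:
  fixes scale :: "'k::field_char_0 \<Rightarrow> 'a::ab_group_add \<Rightarrow> 'a"
  assumes p: "bilinear_map scale p" and q: "bilinear_map scale q"
    and p': "bilinear_map scale p'" and q': "bilinear_map scale q'"
    and D1: "module_hom scale scale D1" and D2: "module_hom scale scale D2"
    and deriv1: "\<And>a b. D1 (q a b) = q a (D1 b) + q (D1 a) b"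
    and deriv2: "\<And>a b. D2 (q' a b) = q' a (D2 b) + q' (D2 a) b"
    and comm: "D1 \<circ> D2 = D2 \<circ> D1"
    and assoc: "\<And>a b c. p (q a b) c = p' a (q' b c)"
  shows "(\<Sum>i\<le>n. exp_twist scale D1 D2 p i (exp_twist scale D1 D2 q (n - i) a b) c)
    = (\<Sum>i\<le>n. exp_twist scale D1 D2 p' i a (exp_twist scale D1 D2 q' (n - i) b c))"
proof -
  interpret module scale by (rule bilinear_map_module[OF p])
  \<comment> \<open>both sides expand into these terms; \<open>u\<close>, \<open>r\<close>, \<open>s\<close> are the powers of \<open>D1 \<otimes> D2 \<otimes> 1\<close>, \<open>D1 \<otimes> 1 \<otimes> D2\<close>
    and \<open>1 \<otimes> D1 \<otimes> D2\<close>\<close>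
  let ?S = "\<lambda>u r s. scale (1 / (fact u * fact r * fact s))
      (p (q ((D1 ^^ (r + u)) a) ((D1 ^^ s) ((D2 ^^ u) b))) ((D2 ^^ (r + s)) c))"
  have left: "exp_twist scale D1 D2 p i (exp_twist scale D1 D2 q j a b) c
      = (\<Sum>r\<le>i. ?S j r (i - r))" for i j
  proof -
    have "exp_twist scale D1 D2 p i (exp_twist scale D1 D2 q j a b) c
        = scale (1 / fact j) (p (scale (1 / fact i)
            ((D1 ^^ i) (q ((D1 ^^ j) a) ((D2 ^^ j) b)))) ((D2 ^^ i) c))"
      by (simp add: exp_twist_def bilinear_map_simps[OF p] mult.commute
          module_hom.scale[OF module_hom_funpow[OF D1]])
    also have "\<dots> = (\<Sum>r\<le>i. ?S j r (i - r))"
      by (simp add: derivation_divided_power[OF q D1 deriv1] bilinear_map_simps[OF p]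
          scale_sum_right funpow_add mult.assoc)
    finally show ?thesis .
  qed
  have right: "exp_twist scale D1 D2 p' i a (exp_twist scale D1 D2 q' j b c)
      = (\<Sum>u\<le>i. ?S u (i - u) j)" for i j
  proof -
    have D2_add: "(D2 ^^ m) ((D2 ^^ n) x) = (D2 ^^ (m + n)) x" for m n x
      by (simp add: funpow_add)
    have "exp_twist scale D1 D2 p' i a (exp_twist scale D1 D2 q' j b c)
        = scale (1 / fact j) (p' ((D1 ^^ i) a) (scale (1 / fact i)
            ((D2 ^^ i) (q' ((D1 ^^ j) b) ((D2 ^^ j) c)))))"
      by (simp add: exp_twist_def bilinear_map_simps[OF p'] mult.commute
          module_hom.scale[OF module_hom_funpow[OF D2]])
    also have "\<dots> = (\<Sum>u\<le>i. scale (1 / fact j * (1 / (fact u * fact (i - u))))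
        (p (q ((D1 ^^ i) a) ((D2 ^^ u) ((D1 ^^ j) b))) ((D2 ^^ (i - u)) ((D2 ^^ j) c))))"
      by (simp add: derivation_divided_power[OF q' D2 deriv2] bilinear_map_simps[OF p']
          scale_sum_right assoc)
    also have "\<dots> = (\<Sum>u\<le>i. ?S u (i - u) j)"
      by (rule sum.cong) (auto simp: funpow_commute[OF comm] D2_add mult_ac)
    finally show ?thesis .
  qed
  have "(\<Sum>i\<le>n. \<Sum>r\<le>i. ?S (n - i) r (i - r)) = (\<Sum>(u, r, s)\<in>triples n. ?S u r s)"
    unfolding sum.Sigma[OF finite_atMost ballI[OF finite_atMost]]
    by (rule sum.reindex_bij_witness[where j = "\<lambda>(i, r). (n - i, r, i - r)"
          and i = "\<lambda>(u, r, s). (r + s, r)"]) (auto simp: triples_def)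
  also have "\<dots> = (\<Sum>i\<le>n. \<Sum>u\<le>i. ?S u (i - u) (n - i))"
    unfolding sum.Sigma[OF finite_atMost ballI[OF finite_atMost]]
    by (rule sum.reindex_bij_witness[where i = "\<lambda>(i, u). (u, i - u, n - i)"
          and j = "\<lambda>(u, r, s). (u + r, u)"]) (auto simp: triples_def)
  finally show ?thesis by (simp only: left right)
qed

theorem theorem3p6:
  fixes scale :: "'k::field_char_0 \<Rightarrow> 'a::ab_group_add \<Rightarrow> 'a"
    and lprod :: "'a \<Rightarrow> 'a \<Rightarrow> 'a" (infixl \<open>\<prec>\<close> 70)
    and rprod :: "'a \<Rightarrow> 'a \<Rightarrow> 'a" (infixl \<open>\<succ>\<close> 70)
    and D1 D2 :: "'a \<Rightarrow> 'a"
  assumes "vector_space scale"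
    and "dendriform_algebra scale (\<prec>) (\<succ>)"
    and "Vector_Spaces.linear scale scale D1"
    and "Vector_Spaces.linear scale scale D2"
    and "\<And>a b. D1 (a \<prec> b) = a \<prec> D1 b + D1 a \<prec> b"
    and "\<And>a b. D1 (a \<succ> b) = a \<succ> D1 b + D1 a \<succ> b"
    and "\<And>a b. D2 (a \<prec> b) = a \<prec> D2 b + D2 a \<prec> b"
    and "\<And>a b. D2 (a \<succ> b) = a \<succ> D2 b + D2 a \<succ> b"
    and "D1 \<circ> D2 = D2 \<circ> D1"
  shows "formal_deformation scale (\<prec>) (\<succ>)
           (tadic_extension (\<lambda>n a b. scale (1 / fact n) ((D1 ^^ n) a \<prec> (D2 ^^ n) b)))
           (tadic_extension (\<lambda>n a b. scale (1 / fact n) ((D1 ^^ n) a \<succ> (D2 ^^ n) b)))"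
proof -
  interpret dendriform_algebra scale "(\<prec>)" "(\<succ>)" by fact
  note l = bilinear_lprod and r = bilinear_rprod
  note s = bilinear_map_add[OF l r]
  have D: "module_hom scale scale D1" "module_hom scale scale D2"
    using assms(3,4) by (simp_all add: linear_iff_module_hom)
  have deriv: "D1 (a \<prec> b + a \<succ> b) = (a \<prec> D1 b + a \<succ> D1 b) + (D1 a \<prec> b + D1 a \<succ> b)"
    "D2 (a \<prec> b + a \<succ> b) = (a \<prec> D2 b + a \<succ> D2 b) + (D2 a \<prec> b + D2 a \<succ> b)" for a b
    by (simp_all add: module_hom.add[OF D(1)] module_hom.add[OF D(2)] assms(5-8) add_ac)
  let ?tw = "exp_twist scale D1 D2"
  let ?L = "tadic_extension (?tw (\<prec>))" and ?R = "tadic_extension (?tw (\<succ>))"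
  have bil: "bilinear_map scale (?tw (\<prec>) n)" "bilinear_map scale (?tw (\<succ>) n)"
    "bilinear_map scale (?tw (\<lambda>a b. a \<prec> b + a \<succ> b) n)" for n
    by (intro bilinear_map_exp_twist D l r s)+
  have sum: "tadic_extension (?tw (\<lambda>a b. a \<prec> b + a \<succ> b)) f g = ?L f g + ?R f g" for f g
    by (simp add: exp_twist_add[OF module_axioms] tadic_extension_add_family)
  have "dendriform_algebra (fps_scale scale) ?L ?R"
  proof (intro dendriform_algebra.intro dendriform_algebra_axioms.intro)
    show "module (fps_scale scale)" by (rule module_fps_scale[OF module_axioms])
    show "bilinear_map (fps_scale scale) ?L" "bilinear_map (fps_scale scale) ?R"
      by (intro bilinear_map_tadic_extension bil)+
    fix f g h
    show "?L (?L f g) h = ?L f (?L g h + ?R g h)"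
      unfolding sum[symmetric]
    proof (rule tadic_extension_assoc[OF bil(1) bil(1)])
      show "(\<Sum>i\<le>n. ?tw (\<prec>) i (?tw (\<prec>) (n - i) a b) c)
          = (\<Sum>i\<le>n. ?tw (\<prec>) i a (?tw (\<lambda>a b. a \<prec> b + a \<succ> b) (n - i) b c))" for n a b c
        by (rule exp_twist_assoc[where p = "(\<prec>)" and q = "(\<prec>)"
              and p' = "(\<prec>)" and q' = "\<lambda>a b. a \<prec> b + a \<succ> b"])
           (fact l l l s D assms(5) deriv(2) assms(9) dendriform1)+
    qed
    show "?L (?R f g) h = ?R f (?L g h)"
    proof (rule tadic_extension_assoc[OF bil(1) bil(2)])
      show "(\<Sum>i\<le>n. ?tw (\<prec>) i (?tw (\<succ>) (n - i) a b) c)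
          = (\<Sum>i\<le>n. ?tw (\<succ>) i a (?tw (\<prec>) (n - i) b c))" for n a b c
        by (rule exp_twist_assoc[where p = "(\<prec>)" and q = "(\<succ>)"
              and p' = "(\<succ>)" and q' = "(\<prec>)"])
           (fact l r r l D assms(6) assms(7) assms(9) dendriform2)+
    qed
    show "?R (?L f g + ?R f g) h = ?R f (?R g h)"
      unfolding sum[symmetric]
    proof (rule tadic_extension_assoc[OF bil(2) bil(2)])
      show "(\<Sum>i\<le>n. ?tw (\<succ>) i (?tw (\<lambda>a b. a \<prec> b + a \<succ> b) (n - i) a b) c)
          = (\<Sum>i\<le>n. ?tw (\<succ>) i a (?tw (\<succ>) (n - i) b c))" for n a b c
        by (rule exp_twist_assoc[where p = "(\<succ>)" and q = "\<lambda>a b. a \<prec> b + a \<succ> b"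
              and p' = "(\<succ>)" and q' = "(\<succ>)"])
           (fact r s r r D deriv(1) assms(8) assms(9) dendriform3)+
    qed
  qed
  moreover have "?tw (\<prec>) 0 = (\<prec>)" "?tw (\<succ>) 0 = (\<succ>)"
    by (simp_all add: exp_twist_def fun_eq_iff)
  ultimately have "formal_deformation scale (\<prec>) (\<succ>) ?L ?R"
    unfolding formal_deformation_def using bil(1,2)
    by (intro conjI exI[of _ "?tw (\<prec>)"] exI[of _ "?tw (\<succ>)"]) simp_all
  then show ?thesis unfolding exp_twist_def[abs_def] .
qed

end
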